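(* Let $a,b,r,s$ be nonzero real numbers. For every non-negative integer $i$, \[ \phi^{a,b}_{i}(x)=\left(\frac{a}{r}\right)^i\sum_{m=0}^{\lfloor i/2\rfloor}\frac{(-s)^m\binom{i}{m}(i-2m+1)}{i-m+1}\ {}_2F_1\!\left(-m,\,-i+m-1;\,-i;\,\frac{b\,r^2}{a^2 s}\right)\phi^{r,s}_{i-2m}(x). \]
   Context: For nonzero reals $p,q$, the generalized Fibonacci polynomials are defined by $\phi^{p,q}_0(x)=1$, $\phi^{p,q}_1(x)=px$, $\phi^{p,q}_j(x)=px\,\phi^{p,q}_{j-1}(x)+q\,\phi^{p,q}_{j-2}(x)$ for $j\ge2$ (used here with $(p,q)=(a,b)$ and $(p,q)=(r,s)$). For a non-negative integer $m$, ${}_2F_1(-m,\beta;\gamma;z)=\sum_{k=0}^{m}\frac{(-m)_k(\beta)_k}{(\gamma)_k}\frac{z^k}{k!}$ with $(u)_k=u(u+1)\cdots(u+k-1)$, $(u)_0=1$ (here $(\gamma)_k\neq0$ for $0\le k\le m$). *)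

theory Defs
  imports Complex_Main "HOL-Computational_Algebra.Polynomial"
begin

fun gen_fib_poly :: "real \<Rightarrow> real \<Rightarrow> nat \<Rightarrow> real poly" where
  "gen_fib_poly p q 0 = 1"
| "gen_fib_poly p q (Suc 0) = [:0, p:]"
| "gen_fib_poly p q (Suc (Suc j)) =
     [:0, p:] * gen_fib_poly p q (Suc j) + smult q (gen_fib_poly p q j)"

text \<open>
  The terminating series \<open>\<^sub>2F\<^sub>1(-m, \<beta>; \<gamma>; z)\<close>: the argument \<open>m\<close> stands for the upper
  parameter \<open>-m\<close>. The explicit upper summation bound \<open>m\<close> matters when \<open>\<gamma>\<close> is a negative integer.
\<close>

definition hyp2F1_term :: "nat \<Rightarrow> real \<Rightarrow> real \<Rightarrow> real \<Rightarrow> real" where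
  "hyp2F1_term m \<beta> \<gamma> z =
     (\<Sum>k=0..m. pochhammer (- real m) k * pochhammer \<beta> k / pochhammer \<gamma> k * (z ^ k / fact k))"

end

theory Submission
  imports Defs
begin

text \<open>
  Expand \<open>\<phi>\<^sup>a\<^sup>,\<^sup>b\<^sub>i\<close> in powers of \<open>a x\<close>, and invert the corresponding expansion of
  \<open>\<phi>\<^sup>r\<^sup>,\<^sup>s\<^sub>n\<close>: the power \<open>(r x)\<^sup>n\<close> is the combination of the \<open>\<phi>\<^sup>r\<^sup>,\<^sup>s\<^sub>n\<^sub>-\<^sub>2\<^sub>m\<close> with coefficients
  \<open>(-s)\<^sup>m\<close> times the ballot numbers, because multiplication by \<open>r x\<close> turns into Pascal's rule.
  Substituting one expansion into the other and collecting the terms with \<open>k + j = m\<close>, the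
  coefficient of \<open>\<phi>\<^sup>r\<^sup>,\<^sup>s\<^sub>i\<^sub>-\<^sub>2\<^sub>m\<close> is a sum over \<open>k \<le> m\<close> that agrees term by term with the
  hypergeometric series.
\<close>

lemma smult_sum_right: "smult c (\<Sum>x\<in>S. f x) = (\<Sum>x\<in>S. smult c (f x))"
  by (induction S rule: infinite_finite_induct) (simp_all add: smult_add_right)

text \<open>For \<open>2 * m \<le> n\<close> this counts the sequences of n votes, m of them for the
  second candidate, in which that candidate is never ahead. The case split stands for the convention
  that binomials with lower index -1 vanish; truncated \<open>m - 1\<close> would give 1
  there.\<close>

definition ballot :: "nat \<Rightarrow> nat \<Rightarrow> real" where
  "ballot n m = real (n choose m) - (if m = 0 then 0 else real (n choose (m - 1)))"

lemma ballot_0 [simp]: "ballot n 0 = 1"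
  by (simp add: ballot_def)

lemma ballot_Suc_Suc: "ballot (Suc n) (Suc m) = ballot n (Suc m) + ballot n m"
  by (cases m) (simp_all add: ballot_def)

text \<open>Symmetry of the binomials makes the two terms equal. This zero is the boundary condition
  that removes the missing polynomial of index -1 when powers are expanded.\<close>

lemma ballot_eq_0:
  assumes "2 * m = Suc n"
  shows "ballot n m = 0"
proof -
  from assms obtain k where k: "m = Suc k" by (cases m) auto
  with assms have "n = 2 * k + 1" by simp
  then have "n choose Suc k = n choose k"
    using binomial_symmetric[of k n] by simp
  with k show ?thesis by (simp add: ballot_def)
qed

text \<open>Over the common denominator m! (n-m+1)! the two binomials leave the numerator (n-m+1) -
  m.\<close>

lemma ballot_closed_form:
  assumes "2 * m \<le> n"
  shows "ballot n m = fact n * (real n - 2 * real m + 1) / (fact m * fact (Suc (n - m)))"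
proof (cases m)
  case 0
  have "1 + real n \<noteq> 0" by linarith
  then show ?thesis using 0 by (simp add: divide_simps)
next
  case (Suc k)
  define d where "d = n - m"
  have n: "n = d + Suc k" using assms Suc by (simp add: d_def)
  have "real (n choose m) = fact n / (fact (Suc k) * fact d)"
    using binomial_fact[of m n, where 'a = real] Suc n by (simp del: fact_Suc binomial_Suc_Suc)
  moreover have "real (n choose k) = fact n / (fact k * fact (Suc d))"
    using binomial_fact[of k n, where 'a = real] n
    by (simp add: Suc_diff_le del: fact_Suc binomial_Suc_Suc)
  ultimately have "ballot n m = fact n / (fact (Suc k) * fact d) - fact n / (fact k * fact (Suc d))"
    using Suc by (simp add: ballot_def)
  also have "\<dots> = fact n * (real (Suc d) - real (Suc k)) / (fact (Suc k) * fact (Suc d))"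
  proof -
    have "fact n / (fact (Suc k) * fact d) = fact n * real (Suc d) / (fact (Suc k) * fact (Suc d))"
      unfolding fact_Suc[of d] by (simp add: mult_ac del: of_nat_Suc fact_Suc)
    moreover have "fact n / (fact k * fact (Suc d))
        = fact n * real (Suc k) / (fact (Suc k) * fact (Suc d))"
      unfolding fact_Suc[of k] by (simp add: mult_ac del: of_nat_Suc fact_Suc)
    ultimately show ?thesis by (simp only: right_diff_distrib diff_divide_distrib)
  qed
  finally have "ballot n m
      = fact n * (real (Suc d) - real (Suc k)) / (fact (Suc k) * fact (Suc d))" .
  moreover have "n - Suc k = d" "real n - 2 * real (Suc k) + 1 = real (Suc d) - real (Suc k)"
    using n by simp_all
  ultimately show ?thesis by (simp only: Suc)
qed

lemma ballot_binomial:
  assumes "2 * m \<le> n"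
  shows "ballot n m = real (n choose m) * (real n - 2 * real m + 1) / (real n - real m + 1)"
proof -
  have "real n - real m + 1 = real (Suc (n - m))" using assms by simp
  then show ?thesis
    using assms by (simp add: ballot_closed_form binomial_fact fact_Suc divide_simps)
qed

text \<open>Up to sign, a rising factorial from -n is a falling factorial from n.\<close>

lemma pochhammer_minus_nat:
  assumes "k \<le> n"
  shows "pochhammer (- real n) k = (- 1) ^ k * fact n / fact (n - k)"
proof -
  have "pochhammer (- real n) k = (- 1) ^ k * fact k * (real n gchoose k)"
    by (simp add: gbinomial_pochhammer flip: power_mult_distrib)
  also have "real n gchoose k = real (n choose k)"
    by (simp add: binomial_gbinomial)
  finally show ?thesis using assms by (simp add: binomial_fact)
qed

text \<open>Both sides are quotients of factorials with the same factor i-2m+1, since (i-2k) -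
  2(m-k) = i-2m. The explicit sign cancels the one left over from the three Pochhammer
  symbols.\<close>

lemma binomial_mult_ballot:
  assumes "2 * m \<le> i" "k \<le> m"
  shows "real ((i - k) choose k) * ballot (i - 2 * k) (m - k) =
    ballot i m * (- 1) ^ k * (pochhammer (- real m) k * pochhammer (- real i + real m - 1) k
      / (pochhammer (- real i) k * fact k))"
proof -
  have d: "i - 2 * k - (m - k) = i - m - k" "i - k - k = i - 2 * k"
    "Suc (i - m) - k = Suc (i - m - k)"
    using assms by auto
  \<comment> \<open>The second equation exhibits the upper parameter as the negative of a natural
    number, so that \<open>pochhammer_minus_nat\<close> applies to it too.\<close>
  have shift: "real (i - 2 * k) - 2 * real (m - k) + 1 = real i - 2 * real m + 1"
    "- real i + real m - 1 = - real (Suc (i - m))"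
    using assms by auto
  have "real ((i - k) choose k) = fact (i - k) / (fact k * fact (i - 2 * k))"
    using assms by (simp add: binomial_fact flip: d(2))
  moreover have "ballot (i - 2 * k) (m - k) =
      fact (i - 2 * k) * (real i - 2 * real m + 1) / (fact (m - k) * fact (Suc (i - m - k)))"
    using ballot_closed_form[of "m - k" "i - 2 * k", unfolded d shift] assms by auto
  moreover have "pochhammer (- real m) k = (- 1) ^ k * fact m / fact (m - k)"
    using assms by (simp add: pochhammer_minus_nat)
  moreover have "pochhammer (- real i) k = (- 1) ^ k * fact i / fact (i - k)"
    using assms by (simp add: pochhammer_minus_nat)
  moreover have "pochhammer (- real i + real m - 1) k
      = (- 1) ^ k * fact (Suc (i - m)) / fact (Suc (i - m - k))"
    using assms pochhammer_minus_nat[of k "Suc (i - m)"] by (simp only: shift d)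
  moreover have "ballot i m
      = fact i * (real i - 2 * real m + 1) / (fact m * fact (Suc (i - m)))"
    using assms by (simp only: ballot_closed_form)
  \<comment> \<open>The letters abstract the factorials: A = (i-k)!, C = (i-2k)!, F = m!, I = i!, K
    = k!, M = (m-k)!, S = (i-m-k+1)!, T = (i-m+1)!; moreover L = i-2m+1 and u = (-1)^k.\<close>
  moreover have cancel: "A / (K * C) * (C * L / (M * S))
      = I * L / (F * T) * u * (u * F / M * (u * T / S) / (u * I / A * K))"
    if "u * u = 1" "A \<noteq> 0" "C \<noteq> 0" "F \<noteq> 0" "I \<noteq> 0" "T \<noteq> 0"
    for A C F I K L M S T u :: real
  proof -
    have "I * L / (F * T) * u * (u * F / M * (u * T / S) / (u * I / A * K))
        = (u * u) * (A * L / (K * (M * S)))"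
      using that by (auto simp: divide_simps)
    then show ?thesis using that by simp
  qed
  moreover have "(- 1 :: real) ^ k * (- 1) ^ k = 1"
    by (simp flip: power_mult_distrib)
  ultimately show ?thesis
    by (simp only: cancel[OF _ fact_nonzero fact_nonzero fact_nonzero fact_nonzero fact_nonzero])
qed

text \<open>The recurrence matches Pascal's rule for the coefficients. Summing up to n instead of
  n/2 adds only terms with zero binomial and keeps the ranges simple in the induction.\<close>

lemma gen_fib_poly_expansion:
  "gen_fib_poly p q n = (\<Sum>k\<le>n. smult (real ((n - k) choose k) * q ^ k) ([:0, p:] ^ (n - 2 * k)))"
proof (induction p q n rule: gen_fib_poly.induct)
  case (3 p q n)
  let ?X = "[:0, p:]"
  define t where "t n k = smult (real ((n - k) choose k) * q ^ k) (?X ^ (n - 2 * k))" for n k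
  have vanish: "t n k = 0" if "n < 2 * k" for n k
    using that by (auto simp: t_def intro!: binomial_eq_0)
  have head: "t (Suc (Suc n)) 0 = ?X * t (Suc n) 0"
    by (simp add: t_def)
  have step: "t (Suc (Suc n)) (Suc k) = ?X * t (Suc n) (Suc k) + smult q (t n k)" if "k \<le> n" for k
  \<comment> \<open>When the exponent \<open>Suc n - 2 * Suc k\<close> is truncated, the law for
    powers of X fails, but the term carrying it has coefficient 0.\<close>
  proof (cases "2 * Suc k \<le> Suc n")
    case True
    define e where "e = Suc n - 2 * Suc k"
    have e: "Suc (Suc n) - Suc k = Suc (n - k)" "Suc n - Suc k = n - k"
      "Suc (Suc n) - 2 * Suc k = Suc e" "Suc n - 2 * Suc k = e" "n - 2 * k = Suc e"
      using True that by (auto simp: e_def)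
    show ?thesis
      by (simp only: t_def e binomial_Suc_Suc power_Suc mult_smult_right smult_smult of_nat_add
          distrib_right smult_add_left) (simp only: ac_simps)
  next
    case False
    then have "t (Suc n) (Suc k) = 0" by (intro vanish) simp
    moreover have "Suc (Suc n) - Suc k = Suc (n - k)" "(n - k) choose Suc k = 0"
      using False that by auto
    ultimately show ?thesis
      by (simp add: t_def mult.commute)
  qed
  have IH: "gen_fib_poly p q (Suc n) = (\<Sum>k\<le>Suc n. t (Suc n) k)"
    "gen_fib_poly p q n = (\<Sum>k\<le>n. t n k)"
    using 3 by (simp_all only: t_def)
  have "(\<Sum>k\<le>Suc (Suc n). t (Suc (Suc n)) k) = (\<Sum>k\<le>Suc n. t (Suc (Suc n)) k)"
    using vanish by simp
  also have "\<dots> = t (Suc (Suc n)) 0 + (\<Sum>k\<le>n. t (Suc (Suc n)) (Suc k))"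
    by (simp only: sum.atMost_Suc_shift)
  also have "(\<Sum>k\<le>n. t (Suc (Suc n)) (Suc k))
      = ?X * (\<Sum>k\<le>n. t (Suc n) (Suc k)) + smult q (\<Sum>k\<le>n. t n k)"
    by (simp only: sum_distrib_left smult_sum_right flip: sum.distrib)
      (rule sum.cong, simp_all only: step atMost_iff)
  also have "t (Suc (Suc n)) 0 + \<dots> = ?X * (\<Sum>k\<le>Suc n. t (Suc n) k) + smult q (\<Sum>k\<le>n. t n k)"
    by (simp only: head sum.atMost_Suc_shift distrib_left add.assoc)
  finally show ?case
    by (simp only: gen_fib_poly.simps IH t_def)
qed (simp_all)

text \<open>Induction on n: the recurrence read backwards, X \<phi>_j = \<phi>_(j+1) - s
  \<phi>_(j-1), sends each term to the indices m and m+1, where \<open>ballot_Suc_Suc\<close>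
  collects the coefficients.\<close>

lemma power_eq_sum_gen_fib_poly:
  "[:0, r:] ^ n = (\<Sum>m\<le>n div 2. smult ((- s) ^ m * ballot n m) (gen_fib_poly r s (n - 2 * m)))"
proof -
  let ?X = "[:0, r:]"
  define g where "g n m = (if 2 * m \<le> n then gen_fib_poly r s (n - 2 * m) else 0)" for n m
  \<comment> \<open>The ballot factor is kept because at \<open>2 * m = Suc n\<close> the bare
    recurrence for \<open>g\<close> fails: the left side is 0, while \<open>g (Suc n) m\<close> is
    1.\<close>
  have mult: "smult (ballot n m) (?X * g n m)
      = smult (ballot n m) (g (Suc n) m - smult s (g (Suc n) (Suc m)))" for n m
  proof -
    consider "2 * m < n" | "2 * m = n" | "2 * m = Suc n" | "Suc n < 2 * m" by linarith
    then show ?thesis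
    proof cases
      case 1
      then obtain d where d: "n = 2 * m + Suc d"
        using less_imp_add_positive[of "2 * m" n] by (metis Suc_pred')
      show ?thesis by (simp add: g_def d)
    qed (auto simp: g_def ballot_eq_0)
  qed
  have "?X ^ n = (\<Sum>m\<le>n. smult ((- s) ^ m * ballot n m) (g n m))"
  proof (induction n)
    case (Suc n)
    define A where "A m = smult ((- s) ^ m * ballot n m) (g (Suc n) m)" for m
    define B where "B m = smult ((- s) ^ Suc m * ballot n m) (g (Suc n) (Suc m))" for m
    have "?X ^ Suc n = (\<Sum>m\<le>n. smult ((- s) ^ m) (smult (ballot n m) (?X * g n m)))"
      by (simp only: power_Suc Suc sum_distrib_left mult_smult_right smult_smult)
    also have "\<dots> = (\<Sum>m\<le>n. A m) + (\<Sum>m\<le>n. B m)"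
      unfolding mult sum.distrib[symmetric]
      by (intro sum.cong) (simp_all add: A_def B_def smult_diff_right mult_ac)
    \<comment> \<open>The added term is 0 by the definition of \<open>g\<close>. After the shift,
      \<open>A (Suc m)\<close> and \<open>B m\<close> are multiples of the same polynomial.\<close>
    also have "(\<Sum>m\<le>n. A m) = (\<Sum>m\<le>Suc n. A m)"
      by (simp add: A_def g_def)
    also have "\<dots> = A 0 + (\<Sum>m\<le>n. A (Suc m))"
      by (rule sum.atMost_Suc_shift)
    also have "\<dots> + (\<Sum>m\<le>n. B m) = A 0 + (\<Sum>m\<le>n. A (Suc m) + B m)"
      by (simp add: sum.distrib add.assoc)
    also have "\<dots> = (\<Sum>m\<le>Suc n. smult ((- s) ^ m * ballot (Suc n) m) (g (Suc n) m))"
      unfolding sum.atMost_Suc_shift A_def B_def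
      by (simp only: ballot_Suc_Suc distrib_left smult_add_left ballot_0)
    finally show ?case .
  qed (simp add: g_def)
  also have "\<dots> = (\<Sum>m\<le>n div 2. smult ((- s) ^ m * ballot n m) (g n m))"
    by (rule sum.mono_neutral_right) (auto simp: g_def)
  also have "\<dots> = (\<Sum>m\<le>n div 2. smult ((- s) ^ m * ballot n m) (gen_fib_poly r s (n - 2 * m)))"
    by (rule sum.cong) (auto simp: g_def)
  finally show ?thesis .
qed

text \<open>The equality holds summand by summand. The argument z of the series is chosen so that
  (a/r)^(2k) (-s)^k z^k = (-b)^k, which restores the powers split off from (a/r)^i and
  (-s)^m.\<close>

lemma sum_ballot_eq_hyp2F1_term:
  assumes "a \<noteq> 0" "r \<noteq> 0" "s \<noteq> 0" "2 * m \<le> i"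
  shows "(\<Sum>k\<le>m. real ((i - k) choose k) * b ^ k * (a / r) ^ (i - 2 * k)
            * ((- s) ^ (m - k) * ballot (i - 2 * k) (m - k)))
    = (a / r) ^ i * ((- s) ^ m * ballot i m
        * hyp2F1_term m (- real i + real m - 1) (- real i) (b * r\<^sup>2 / (a\<^sup>2 * s)))"
proof -
  have summand: "real ((i - k) choose k) * b ^ k * (a / r) ^ (i - 2 * k)
        * ((- s) ^ (m - k) * ballot (i - 2 * k) (m - k))
      = (a / r) ^ i * ((- s) ^ m * ballot i m
        * (pochhammer (- real m) k * pochhammer (- real i + real m - 1) k / pochhammer (- real i) k
            * ((b * r\<^sup>2 / (a\<^sup>2 * s)) ^ k / fact k)))" if "k \<le> m" for k
  proof -
    let ?z = "(b * r\<^sup>2 / (a\<^sup>2 * s)) ^ k"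
    let ?q = "pochhammer (- real m) k * pochhammer (- real i + real m - 1) k
      / (pochhammer (- real i) k * fact k)"
    have split: "(a / r) ^ i = (a / r) ^ (i - 2 * k) * ((a / r)\<^sup>2) ^ k"
      "(- s) ^ m = (- s) ^ (m - k) * (- s) ^ k"
      using that assms(4) by (simp_all flip: power_mult power_add)
    have z: "((a / r)\<^sup>2) ^ k * (- s) ^ k * ?z = (- 1) ^ k * b ^ k"
      unfolding power_mult_distrib[symmetric] using assms by (simp add: power_divide)
    have "(a / r) ^ i * ((- s) ^ m * ballot i m * (?q * ?z))
        = (a / r) ^ (i - 2 * k) * (- s) ^ (m - k) * ballot i m * ?q
          * (((a / r)\<^sup>2) ^ k * (- s) ^ k * ?z)"
      unfolding split by (simp only: mult_ac)
    also have "\<dots> = (a / r) ^ (i - 2 * k) * (- s) ^ (m - k) * b ^ k * (ballot i m * (- 1) ^ k * ?q)"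
      unfolding z by (simp only: mult_ac)
    also have "\<dots> = real ((i - k) choose k) * b ^ k * (a / r) ^ (i - 2 * k)
        * ((- s) ^ (m - k) * ballot (i - 2 * k) (m - k))"
      unfolding binomial_mult_ballot[OF assms(4) that, symmetric] by (simp only: mult_ac)
    finally show ?thesis by simp
  qed
  show ?thesis
    unfolding hyp2F1_term_def sum_distrib_left
    by (intro sum.cong) (auto simp: summand atLeast0AtMost)
qed

theorem theorem3:
  fixes a b r s :: real and i :: nat
  assumes "a \<noteq> 0" and "b \<noteq> 0" and "r \<noteq> 0" and "s \<noteq> 0"
  shows "gen_fib_poly a b i =
    smult ((a / r) ^ i)
      (\<Sum>m=0..i div 2.
         smult ((- s) ^ m * real (i choose m) * (real i - 2 * real m + 1) / (real i - real m + 1)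
                * hyp2F1_term m (- real i + real m - 1) (- real i) (b * r\<^sup>2 / (a\<^sup>2 * s)))
           (gen_fib_poly r s (i - 2 * m)))"
proof -
  let ?N = "i div 2"
  let ?F = "\<lambda>m. hyp2F1_term m (- real i + real m - 1) (- real i) (b * r\<^sup>2 / (a\<^sup>2 * s))"
  define c where "c k = real ((i - k) choose k) * b ^ k * (a / r) ^ (i - 2 * k)" for k
  define d where "d k j = (- s) ^ j * ballot (i - 2 * k) j" for k j
  define \<phi> where "\<phi> k = gen_fib_poly r s (i - 2 * k)" for k
  have X: "[:0, a:] = smult (a / r) [:0, r:]"
    using assms by simp
  have "gen_fib_poly a b i
      = (\<Sum>k\<le>i. smult (real ((i - k) choose k) * b ^ k) ([:0, a:] ^ (i - 2 * k)))"
    by (rule gen_fib_poly_expansion)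
  also have "\<dots> = (\<Sum>k\<le>?N. smult (real ((i - k) choose k) * b ^ k) ([:0, a:] ^ (i - 2 * k)))"
    by (rule sum.mono_neutral_right) auto
  also have "\<dots> = (\<Sum>k\<le>?N. smult (c k) ([:0, r:] ^ (i - 2 * k)))"
    unfolding X smult_power by (simp add: c_def)
  \<comment> \<open>Each power of rx is expanded. Removing 2k from the degree lowers the bound by
    exactly k, so the pairs (k, j) fill the triangle \<open>k + j \<le> ?N\<close>, which is then
    summed along the diagonals k + j = m.\<close>
  also have "\<dots> = (\<Sum>k\<le>?N. \<Sum>j\<le>?N - k. smult (c k * d k j) (\<phi> (k + j)))"
  proof (rule sum.cong)
    fix k assume "k \<in> {..?N}"
    have "(i - 2 * k) div 2 = ?N - k" by simp
    then show "smult (c k) ([:0, r:] ^ (i - 2 * k))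
        = (\<Sum>j\<le>?N - k. smult (c k * d k j) (\<phi> (k + j)))"
      by (simp add: power_eq_sum_gen_fib_poly[of r _ s] smult_sum_right d_def \<phi>_def algebra_simps)
  qed simp
  also have "\<dots> = (\<Sum>(k, j)\<in>{(k, j). k + j \<le> ?N}. smult (c k * d k j) (\<phi> (k + j)))"
    by (subst sum.Sigma) (auto intro!: sum.cong)
  also have "\<dots> = (\<Sum>m\<le>?N. \<Sum>k\<le>m. smult (c k * d k (m - k)) (\<phi> (k + (m - k))))"
    by (rule sum.triangle_reindex_eq)
  also have "\<dots> = (\<Sum>m\<le>?N. smult (\<Sum>k\<le>m. c k * d k (m - k)) (\<phi> m))"
    by (simp add: smult_sum)
  also have "\<dots> = (\<Sum>m\<le>?N. smult ((a / r) ^ i * ((- s) ^ m * ballot i m * ?F m)) (\<phi> m))"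
    using assms by (intro sum.cong) (auto simp: c_def d_def sum_ballot_eq_hyp2F1_term)
  also have "\<dots> = (\<Sum>m\<le>?N. smult ((a / r) ^ i * ((- s) ^ m * real (i choose m)
      * (real i - 2 * real m + 1) / (real i - real m + 1) * ?F m)) (\<phi> m))"
  proof (rule sum.cong)
    fix m assume "m \<in> {..?N}"
    then have "2 * m \<le> i" by auto
    then show "smult ((a / r) ^ i * ((- s) ^ m * ballot i m * ?F m)) (\<phi> m)
        = smult ((a / r) ^ i * ((- s) ^ m * real (i choose m)
            * (real i - 2 * real m + 1) / (real i - real m + 1) * ?F m)) (\<phi> m)"
      by (simp only: ballot_binomial times_divide_eq_right mult.assoc)
  qed simp
  also have "\<dots> = smult ((a / r) ^ i) (\<Sum>m=0..?N. smult ((- s) ^ m * real (i choose m)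
      * (real i - 2 * real m + 1) / (real i - real m + 1) * ?F m) (\<phi> m))"
    by (simp only: smult_sum_right atLeast0AtMost smult_smult)
  finally show ?thesis
    by (simp only: \<phi>_def)
qed

end
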